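(* Let $W_{(\alpha,\beta)}$ be a $2$-variable weighted shift. If $\widetilde{W}_{(\alpha,\beta)}=\widehat{W}_{(\alpha,\beta)}=W_{(\alpha,\beta)}$, then $W_{(\alpha,\beta)}$ is (jointly) quasinormal.
   Context: Let $\mathbb{Z}_+=\{0,1,2,\dots\}$, let $\{e_{\mathbf{k}}\}_{\mathbf{k}\in\mathbb{Z}_+^2}$ be the canonical orthonormal basis of $\ell^2(\mathbb{Z}_+^2)$, and let $\varepsilon_1=(1,0)$, $\varepsilon_2=(0,1)$. Given bounded families of positive real numbers $\alpha=\{\alpha_{\mathbf{k}}\}$, $\beta=\{\beta_{\mathbf{k}}\}$ ($\mathbf{k}\in\mathbb{Z}_+^2$), the $2$-variable weighted shift $W_{(\alpha,\beta)}\equiv(T_1,T_2)$ is the pair of bounded operators on $\ell^2(\mathbb{Z}_+^2)$ given by $T_1e_{\mathbf{k}}=\alpha_{\mathbf{k}}e_{\mathbf{k}+\varepsilon_1}$ and $T_2e_{\mathbf{k}}=\beta_{\mathbf{k}}e_{\mathbf{k}+\varepsilon_2}$. All $2$-variable weighted shifts are assumed commuting: $T_1T_2=T_2T_1$, i.e. $\beta_{\mathbf{k}+\varepsilon_1}\alpha_{\mathbf{k}}=\alpha_{\mathbf{k}+\varepsilon_2}\beta_{\mathbf{k}}$ for all $\mathbf{k}$. For a commuting pair $\mathbf{T}=(T_1,T_2)$: the toral Aluthge transform is $\widetilde{\mathbf{T}}=(|T_1|^{1/2}U_1|T_1|^{1/2},\,|T_2|^{1/2}U_2|T_2|^{1/2})$,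 where $T_i=U_i|T_i|$ is the canonical polar decomposition ($\ker U_i=\ker T_i$). The spherical Aluthge transform is $\widehat{\mathbf{T}}=(\sqrt{P}V_1\sqrt{P},\sqrt{P}V_2\sqrt{P})$, where $P=\sqrt{T_1^*T_1+T_2^*T_2}$ and $\begin{pmatrix} T_1 \\ {T_2} \end{pmatrix}=\begin{pmatrix} V_1 \\ {V_2} \end{pmatrix}P$ is the polar decomposition of the column operator $\begin{pmatrix} T_1 \\ {T_2} \end{pmatrix}:\mathcal{H}\to\mathcal{H}\oplus\mathcal{H}$ (so $V_1^*V_1+V_2^*V_2$ is the identity on $(\ker T_1\cap\ker T_2)^\perp$ and $\ker V_1\cap\ker V_2=\ker T_1\cap\ker T_2$). A commuting pair $(T_1,T_2)$ is (jointly) quasinormal if $T_i$ commutes with $T_j^*T_j$ for all $i,j\in\{1,2\}$. *)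

theory Defs
  imports "HOL-Analysis.Analysis"
begin

section \<open>Complex Hilbert spaces\<close>

text \<open>
  A complex Hilbert space is a complete real inner product space carrying a compatible complex
  structure. The complex inner product is linear in the first and conjugate-linear in the second
  argument; the real inner product of the library is its real part, so that norm and topology are
  those of the library.
\<close>

class chilbert_space = real_inner + complete_space +
  fixes scaleC :: "complex \<Rightarrow> 'a \<Rightarrow> 'a" (infixr "*\<^sub>C" 75)
    and cinner :: "'a \<Rightarrow> 'a \<Rightarrow> complex"
  assumes scaleC_add_right: "c *\<^sub>C (x + y) = c *\<^sub>C x + c *\<^sub>C y"
    and scaleC_add_left: "(c + d) *\<^sub>C x = c *\<^sub>C x + d *\<^sub>C x"
    and scaleC_scaleC: "c *\<^sub>C d *\<^sub>C x = (c * d) *\<^sub>C x"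
    and scaleC_of_real: "complex_of_real r *\<^sub>C x = r *\<^sub>R x"
    and cinner_commute: "cinner x y = cnj (cinner y x)"
    and cinner_add_left: "cinner (x + y) z = cinner x z + cinner y z"
    and cinner_scaleC_left: "cinner (c *\<^sub>C x) y = c * cinner x y"
    and inner_eq_Re_cinner: "inner x y = Re (cinner x y)"

text \<open>The Hilbert space direct sum.\<close>

instantiation prod :: (chilbert_space, chilbert_space) chilbert_space
begin

definition scaleC_prod :: "complex \<Rightarrow> 'a \<times> 'b \<Rightarrow> 'a \<times> 'b" where
  "scaleC_prod c x = (c *\<^sub>C fst x, c *\<^sub>C snd x)"

definition cinner_prod :: "'a \<times> 'b \<Rightarrow> 'a \<times> 'b \<Rightarrow> complex" where
  "cinner_prod x y = cinner (fst x) (fst y) + cinner (snd x) (snd y)"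

instance
proof
  fix x y z :: "'a \<times> 'b" and c d :: complex and r :: real
  show "c *\<^sub>C (x + y) = c *\<^sub>C x + c *\<^sub>C y"
    by (simp add: scaleC_prod_def scaleC_add_right)
  show "(c + d) *\<^sub>C x = c *\<^sub>C x + d *\<^sub>C x"
    by (simp add: scaleC_prod_def scaleC_add_left)
  show "c *\<^sub>C d *\<^sub>C x = (c * d) *\<^sub>C x"
    by (simp add: scaleC_prod_def scaleC_scaleC)
  show "complex_of_real r *\<^sub>C x = r *\<^sub>R x"
    by (simp add: scaleC_prod_def scaleC_of_real scaleR_prod_def)
  show "cinner x y = cnj (cinner y x)"
    unfolding cinner_prod_def complex_cnj_add by (intro arg_cong2[where f = "(+)"] cinner_commute)
  show "cinner (x + y) z = cinner x z + cinner y z"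
    by (simp add: cinner_prod_def cinner_add_left)
  show "cinner (c *\<^sub>C x) y = c * cinner x y"
    by (simp add: cinner_prod_def scaleC_prod_def cinner_scaleC_left distrib_left)
  show "inner x y = Re (cinner x y)"
    by (simp add: cinner_prod_def inner_prod_def inner_eq_Re_cinner)
qed

end


section \<open>Bounded operators, square roots and polar decompositions\<close>

definition bounded_clinear :: "('a::chilbert_space \<Rightarrow> 'b::chilbert_space) \<Rightarrow> bool" where
  "bounded_clinear T \<longleftrightarrow> bounded_linear T \<and> (\<forall>c x. T (c *\<^sub>C x) = c *\<^sub>C T x)"

definition cadjoint :: "('a::chilbert_space \<Rightarrow> 'b::chilbert_space) \<Rightarrow> 'b \<Rightarrow> 'a" where
  "cadjoint T = (THE S. bounded_clinear S \<and> (\<forall>x y. cinner (T x) y = cinner x (S y)))"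

definition positive_op :: "('a::chilbert_space \<Rightarrow> 'a) \<Rightarrow> bool" where
  "positive_op A \<longleftrightarrow> bounded_clinear A \<and> (\<forall>x. cinner (A x) x \<in> \<real>\<^sub>\<ge>\<^sub>0)"

definition op_sqrt :: "('a::chilbert_space \<Rightarrow> 'a) \<Rightarrow> 'a \<Rightarrow> 'a" where
  "op_sqrt A = (THE B. positive_op B \<and> B \<circ> B = A)"

definition op_abs :: "('a::chilbert_space \<Rightarrow> 'b::chilbert_space) \<Rightarrow> 'a \<Rightarrow> 'a" where
  "op_abs T = op_sqrt (cadjoint T \<circ> T)"

definition op_kernel :: "('a::chilbert_space \<Rightarrow> 'b::chilbert_space) \<Rightarrow> 'a set" where
  "op_kernel T = {x. T x = 0}"

definition ocomplement :: "'a::chilbert_space set \<Rightarrow> 'a set" where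
  "ocomplement M = {x. \<forall>y\<in>M. cinner x y = 0}"

definition partial_isometry :: "('a::chilbert_space \<Rightarrow> 'b::chilbert_space) \<Rightarrow> bool" where
  "partial_isometry V \<longleftrightarrow>
     bounded_clinear V \<and> (\<forall>x \<in> ocomplement (op_kernel V). norm (V x) = norm x)"

text \<open>
  The partial isometry \<open>V\<close> of the canonical polar decomposition \<open>T = V P\<close>, where \<open>P\<close> is the
  modulus of \<open>T\<close>. For the column operator \<open>T x = (T\<^sub>1 x, T\<^sub>2 x)\<close> the kernel of \<open>T\<close> is the intersection of the
  kernels of \<open>T\<^sub>1\<close> and \<open>T\<^sub>2\<close>.
\<close>

definition polar_factor ::
    "('a::chilbert_space \<Rightarrow> 'b::chilbert_space) \<Rightarrow> ('a \<Rightarrow> 'a) \<Rightarrow> 'a \<Rightarrow> 'b" where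
  "polar_factor T P = (THE V. partial_isometry V \<and> T = V \<circ> P \<and> op_kernel V = op_kernel T)"


section \<open>Aluthge transforms and quasinormality of pairs\<close>

type_synonym 'a op_pair = "('a \<Rightarrow> 'a) \<times> ('a \<Rightarrow> 'a)"

definition aluthge :: "('a::chilbert_space \<Rightarrow> 'a) \<Rightarrow> 'a \<Rightarrow> 'a" where
  "aluthge T = op_sqrt (op_abs T) \<circ> polar_factor T (op_abs T) \<circ> op_sqrt (op_abs T)"

definition toral_aluthge :: "'a::chilbert_space op_pair \<Rightarrow> 'a op_pair" where
  "toral_aluthge = (\<lambda>(T\<^sub>1, T\<^sub>2). (aluthge T\<^sub>1, aluthge T\<^sub>2))"

definition column_op :: "'a::chilbert_space op_pair \<Rightarrow> 'a \<Rightarrow> 'a \<times> 'a" where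
  "column_op = (\<lambda>(T\<^sub>1, T\<^sub>2) x. (T\<^sub>1 x, T\<^sub>2 x))"

definition spherical_modulus :: "'a::chilbert_space op_pair \<Rightarrow> 'a \<Rightarrow> 'a" where
  "spherical_modulus =
     (\<lambda>(T\<^sub>1, T\<^sub>2). op_sqrt (\<lambda>x. cadjoint T\<^sub>1 (T\<^sub>1 x) + cadjoint T\<^sub>2 (T\<^sub>2 x)))"

definition spherical_aluthge :: "'a::chilbert_space op_pair \<Rightarrow> 'a op_pair" where
  "spherical_aluthge T =
     (let P = spherical_modulus T;
          V = polar_factor (column_op T) P
      in (op_sqrt P \<circ> (fst \<circ> V) \<circ> op_sqrt P, op_sqrt P \<circ> (snd \<circ> V) \<circ> op_sqrt P))"

definition commuting_pair :: "'a::chilbert_space op_pair \<Rightarrow> bool" where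
  "commuting_pair = (\<lambda>(T\<^sub>1, T\<^sub>2).
     bounded_clinear T\<^sub>1 \<and> bounded_clinear T\<^sub>2 \<and> T\<^sub>1 \<circ> T\<^sub>2 = T\<^sub>2 \<circ> T\<^sub>1)"

definition jointly_quasinormal :: "'a::chilbert_space op_pair \<Rightarrow> bool" where
  "jointly_quasinormal = (\<lambda>(T\<^sub>1, T\<^sub>2). commuting_pair (T\<^sub>1, T\<^sub>2) \<and>
     (\<forall>A \<in> {T\<^sub>1, T\<^sub>2}. \<forall>B \<in> {T\<^sub>1, T\<^sub>2}.
        A \<circ> (cadjoint B \<circ> B) = (cadjoint B \<circ> B) \<circ> A))"


section \<open>The Hilbert space of square-summable families\<close>

typedef 'i ell2 = "{x :: 'i \<Rightarrow> complex. (\<lambda>i. (cmod (x i))\<^sup>2) summable_on UNIV}"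
  morphisms ell2_coord Abs_ell2
  by (rule exI[of _ "\<lambda>_. 0"]) simp

setup_lifting type_definition_ell2

lemma ell2_prod_summable:
  assumes "(\<lambda>i. (cmod (x i))\<^sup>2) summable_on (UNIV :: 'i set)"
    and "(\<lambda>i. (cmod (y i))\<^sup>2) summable_on (UNIV :: 'i set)"
  shows "(\<lambda>i. x i * cnj (y i)) summable_on UNIV"
proof (rule abs_summable_summable)
  have "cmod (x i * cnj (y i)) \<le> (cmod (x i))\<^sup>2 + (cmod (y i))\<^sup>2" for i
  proof -
    have "2 * (cmod (x i) * cmod (y i)) \<le> (cmod (x i))\<^sup>2 + (cmod (y i))\<^sup>2"
      using sum_squares_bound[of "cmod (x i)" "cmod (y i)"] by (simp add: mult.assoc)
    moreover have "0 \<le> cmod (x i) * cmod (y i)" by simp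
    ultimately show ?thesis unfolding norm_mult complex_mod_cnj by linarith
  qed
  then show "(\<lambda>i. norm (x i * cnj (y i))) summable_on UNIV"
    by (intro summable_on_comparison_test[OF summable_on_add[OF assms]]) auto
qed

lemma ell2_add_summable:
  assumes "(\<lambda>i. (cmod (x i))\<^sup>2) summable_on (UNIV :: 'i set)"
    and "(\<lambda>i. (cmod (y i))\<^sup>2) summable_on (UNIV :: 'i set)"
  shows "(\<lambda>i. (cmod (x i + y i))\<^sup>2) summable_on UNIV"
proof -
  have "(cmod (x i + y i))\<^sup>2 \<le> 2 * (cmod (x i))\<^sup>2 + 2 * (cmod (y i))\<^sup>2" for i
  proof -
    have "(cmod (x i + y i))\<^sup>2 \<le> (cmod (x i) + cmod (y i))\<^sup>2"
      by (intro power_mono norm_triangle_ineq) auto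
    also have "\<dots> \<le> 2 * (cmod (x i))\<^sup>2 + 2 * (cmod (y i))\<^sup>2"
      using sum_squares_bound[of "cmod (x i)" "cmod (y i)"] by (simp add: power2_sum)
    finally show ?thesis .
  qed
  then show ?thesis
    by (intro summable_on_comparison_test[OF summable_on_add[OF
          summable_on_cmult_right[OF assms(1), of 2] summable_on_cmult_right[OF assms(2), of 2]]]) auto
qed

lemma ell2_scale_summable:
  assumes "(\<lambda>i. (cmod (x i))\<^sup>2) summable_on (UNIV :: 'i set)"
  shows "(\<lambda>i. (cmod (c * x i))\<^sup>2) summable_on UNIV"
  using summable_on_cmult_right[OF assms, of "(cmod c)\<^sup>2"]
  by (simp add: norm_mult power_mult_distrib)

instantiation ell2 :: (type) real_inner
begin

lift_definition zero_ell2 :: "'a ell2" is "\<lambda>_. 0" by simp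

lift_definition plus_ell2 :: "'a ell2 \<Rightarrow> 'a ell2 \<Rightarrow> 'a ell2" is "\<lambda>x y i. x i + y i"
  by (rule ell2_add_summable)

lift_definition uminus_ell2 :: "'a ell2 \<Rightarrow> 'a ell2" is "\<lambda>x i. - x i" by simp

lift_definition scaleR_ell2 :: "real \<Rightarrow> 'a ell2 \<Rightarrow> 'a ell2" is "\<lambda>r x i. complex_of_real r * x i"
  by (rule ell2_scale_summable)

lift_definition inner_ell2 :: "'a ell2 \<Rightarrow> 'a ell2 \<Rightarrow> real"
  is "\<lambda>x y. Re (\<Sum>\<^sub>\<infinity>i. x i * cnj (y i))" .

definition minus_ell2 :: "'a ell2 \<Rightarrow> 'a ell2 \<Rightarrow> 'a ell2" where
  "minus_ell2 x y = x + - y"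

definition norm_ell2 :: "'a ell2 \<Rightarrow> real" where
  "norm_ell2 x = sqrt (inner x x)"

definition dist_ell2 :: "'a ell2 \<Rightarrow> 'a ell2 \<Rightarrow> real" where
  "dist_ell2 x y = norm (x - y)"

definition sgn_ell2 :: "'a ell2 \<Rightarrow> 'a ell2" where
  "sgn_ell2 x = inverse (norm x) *\<^sub>R x"

definition uniformity_ell2 :: "('a ell2 \<times> 'a ell2) filter" where
  "uniformity_ell2 = (INF e\<in>{0<..}. principal {(x, y). dist x y < e})"

definition open_ell2 :: "'a ell2 set \<Rightarrow> bool" where
  "open_ell2 U \<longleftrightarrow> (\<forall>x\<in>U. \<forall>\<^sub>F (x', y) in uniformity. x' = x \<longrightarrow> y \<in> U)"

lemma inner_ell2_self: "inner x x = (\<Sum>\<^sub>\<infinity>i. (cmod (ell2_coord x i))\<^sup>2)"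
proof -
  have "(\<lambda>i. ell2_coord x i * cnj (ell2_coord x i)) summable_on UNIV"
    using ell2_coord[of x] by (auto intro: ell2_prod_summable)
  then have "inner x x = (\<Sum>\<^sub>\<infinity>i. Re (ell2_coord x i * cnj (ell2_coord x i)))"
    by (simp only: inner_ell2.rep_eq infsum_Re)
  then show ?thesis
    by (simp only: complex_norm_square[symmetric] Re_complex_of_real)
qed

instance
proof
  fix x y z :: "'a ell2" and r s :: real
  show "x + y + z = x + (y + z)" by transfer (simp add: add.assoc)
  show "x + y = y + x" by transfer (simp add: add.commute)
  show "0 + x = x" by transfer simp
  show "- x + x = 0" by transfer simp
  show "x - y = x + - y" by (rule minus_ell2_def)
  show "r *\<^sub>R (x + y) = r *\<^sub>R x + r *\<^sub>R y" by transfer (simp add: distrib_left)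
  show "(r + s) *\<^sub>R x = r *\<^sub>R x + s *\<^sub>R x" by transfer (simp add: distrib_right)
  show "r *\<^sub>R s *\<^sub>R x = (r * s) *\<^sub>R x" by transfer (simp add: mult.assoc)
  show "1 *\<^sub>R x = x" by transfer simp
  show "dist x y = norm (x - y)" by (rule dist_ell2_def)
  show "sgn x = inverse (norm x) *\<^sub>R x" by (rule sgn_ell2_def)
  show "uniformity = (INF e\<in>{0<..}. principal {(x :: 'a ell2, y). dist x y < e})"
    by (rule uniformity_ell2_def)
  show "open U \<longleftrightarrow> (\<forall>x\<in>U. \<forall>\<^sub>F (x', y) in uniformity. x' = x \<longrightarrow> y \<in> U)" for U :: "'a ell2 set"
    by (rule open_ell2_def)
  show "inner x y = inner y x"
  proof transfer
    fix x y :: "'a \<Rightarrow> complex"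
    have "(\<Sum>\<^sub>\<infinity>i. x i * cnj (y i)) = cnj (\<Sum>\<^sub>\<infinity>i. y i * cnj (x i))"
      by (simp add: infsum_cnj[symmetric] mult.commute del: infsum_cnj)
    then show "Re (\<Sum>\<^sub>\<infinity>i. x i * cnj (y i)) = Re (\<Sum>\<^sub>\<infinity>i. y i * cnj (x i))" by simp
  qed
  show "inner (x + y) z = inner x z + inner y z"
    by transfer (simp add: distrib_right infsum_add ell2_prod_summable)
  show "inner (r *\<^sub>R x) y = r * inner x y"
    by transfer (simp add: mult.assoc infsum_cmult_right')
  show "0 \<le> inner x x"
    unfolding inner_ell2_self by (simp add: infsum_nonneg)
  show "inner x x = 0 \<longleftrightarrow> x = 0"
  proof
    assume *: "inner x x = 0"
    have "(cmod (ell2_coord x i))\<^sup>2 = 0" for i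
      by (rule nonneg_infsum_le_0D[where A = UNIV and f = "\<lambda>i. (cmod (ell2_coord x i))\<^sup>2"])
        (use * ell2_coord[of x] in \<open>auto simp: inner_ell2_self\<close>)
    then show "x = 0" by transfer (simp add: fun_eq_iff)
  next
    assume "x = 0"
    then show "inner x x = 0" by (simp add: inner_ell2_self zero_ell2.rep_eq)
  qed
  show "norm x = sqrt (inner x x)" by (rule norm_ell2_def)
qed

end

lemma ell2_coord_diff: "ell2_coord (x - y) i = ell2_coord x i - ell2_coord y i"
  unfolding minus_ell2_def plus_ell2.rep_eq uminus_ell2.rep_eq by (rule add_uminus_conv_diff)

lemma ell2_norm_square: "(norm x)\<^sup>2 = (\<Sum>\<^sub>\<infinity>i. (cmod (ell2_coord x i))\<^sup>2)"
  by (simp add: power2_norm_eq_inner inner_ell2_self)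

lemma ell2_sum_le_norm:
  assumes "finite F"
  shows "(\<Sum>i\<in>F. (cmod (ell2_coord x i))\<^sup>2) \<le> (norm x)\<^sup>2"
  unfolding ell2_norm_square using ell2_coord[of x] assms by (intro finite_sum_le_infsum) auto

lemma ell2_coord_le_norm: "cmod (ell2_coord x i) \<le> norm x"
  using ell2_sum_le_norm[of "{i}" x] power2_le_imp_le[of "cmod (ell2_coord x i)" "norm x"] by simp

instance ell2 :: (type) complete_space
proof
  fix X :: "nat \<Rightarrow> 'a ell2"
  assume C: "Cauchy X"
  have "Cauchy (\<lambda>n. ell2_coord (X n) i)" for i
  proof (rule metric_CauchyI)
    fix e :: real assume "0 < e"
    then obtain M where M: "\<forall>m\<ge>M. \<forall>n\<ge>M. dist (X m) (X n) < e"
      using metric_CauchyD[OF C] by blast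
    have "dist (ell2_coord (X m) i) (ell2_coord (X n) i) \<le> dist (X m) (X n)" for m n
      using ell2_coord_le_norm[of "X m - X n" i] by (simp add: dist_norm ell2_coord_diff)
    with M show "\<exists>M. \<forall>m\<ge>M. \<forall>n\<ge>M. dist (ell2_coord (X m) i) (ell2_coord (X n) i) < e"
      by (meson order_le_less_trans)
  qed
  then have "\<forall>i. \<exists>l. (\<lambda>n. ell2_coord (X n) i) \<longlonglongrightarrow> l"
    unfolding Cauchy_convergent_iff convergent_def by blast
  then obtain L where L: "\<And>i. (\<lambda>n. ell2_coord (X n) i) \<longlonglongrightarrow> L i"
    by metis
  have bound: "(\<Sum>i\<in>F. (cmod (ell2_coord (X n) i - L i))\<^sup>2) \<le> e\<^sup>2"
    if "finite F" "\<forall>m\<ge>M. \<forall>n\<ge>M. dist (X m) (X n) < e" "n \<ge> M" for F n M e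
  proof (rule Lim_bounded)
    show "(\<lambda>m. \<Sum>i\<in>F. (cmod (ell2_coord (X n) i - ell2_coord (X m) i))\<^sup>2)
        \<longlonglongrightarrow> (\<Sum>i\<in>F. (cmod (ell2_coord (X n) i - L i))\<^sup>2)"
      by (intro tendsto_intros L)
    show "\<forall>m\<ge>M. (\<Sum>i\<in>F. (cmod (ell2_coord (X n) i - ell2_coord (X m) i))\<^sup>2) \<le> e\<^sup>2"
    proof (intro allI impI)
      fix m assume "m \<ge> M"
      then have "norm (X n - X m) \<le> e" using that by (metis dist_norm less_imp_le)
      then have "(norm (X n - X m))\<^sup>2 \<le> e\<^sup>2" by (intro power_mono) auto
      then show "(\<Sum>i\<in>F. (cmod (ell2_coord (X n) i - ell2_coord (X m) i))\<^sup>2) \<le> e\<^sup>2"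
        using ell2_sum_le_norm[OF that(1), of "X n - X m"] by (simp add: ell2_coord_diff)
    qed
  qed
  have summ: "(\<lambda>i. (cmod (ell2_coord (X n) i - L i))\<^sup>2) summable_on UNIV"
    if "\<forall>m\<ge>M. \<forall>n\<ge>M. dist (X m) (X n) < e" "n \<ge> M" for n M e
  proof (rule nonneg_bdd_above_summable_on)
    show "bdd_above (sum (\<lambda>i. (cmod (ell2_coord (X n) i - L i))\<^sup>2) ` {F. F \<subseteq> UNIV \<and> finite F})"
      by (rule bdd_aboveI2[where M = "e\<^sup>2"]) (use bound[OF _ that] in simp)
  qed simp
  obtain M0 where M0: "\<forall>m\<ge>M0. \<forall>n\<ge>M0. dist (X m) (X n) < 1"
    using metric_CauchyD[OF C, of 1] by auto
  have "(\<lambda>i. (cmod (L i))\<^sup>2) summable_on UNIV"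
  proof -
    have "(\<lambda>i. (cmod (ell2_coord (X M0) i + (-1) * (ell2_coord (X M0) i - L i)))\<^sup>2) summable_on UNIV"
      by (intro ell2_add_summable ell2_scale_summable summ[OF M0 order_refl])
        (use ell2_coord[of "X M0"] in simp)
    then show ?thesis by simp
  qed
  then have coord_L: "ell2_coord (Abs_ell2 L) = L" by (simp add: Abs_ell2_inverse)
  have "X \<longlonglongrightarrow> Abs_ell2 L"
  proof (rule metric_LIMSEQ_I)
    fix e :: real assume "0 < e"
    then obtain M where M: "\<forall>m\<ge>M. \<forall>n\<ge>M. dist (X m) (X n) < e / 2"
      using metric_CauchyD[OF C, of "e / 2"] by auto
    show "\<exists>no. \<forall>n\<ge>no. dist (X n) (Abs_ell2 L) < e"
    proof (intro exI allI impI)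
      fix n assume n: "n \<ge> M"
      have "(norm (X n - Abs_ell2 L))\<^sup>2 \<le> (e / 2)\<^sup>2"
        unfolding ell2_norm_square ell2_coord_diff coord_L
        by (intro infsum_le_finite_sums summ[OF M n] bound[OF _ M n])
      then have "norm (X n - Abs_ell2 L) \<le> e / 2"
        by (rule power2_le_imp_le) (use \<open>0 < e\<close> in simp)
      then show "dist (X n) (Abs_ell2 L) < e" using \<open>0 < e\<close> by (simp add: dist_norm)
    qed
  qed
  then show "convergent X" by (auto simp: convergent_def)
qed

instantiation ell2 :: (type) chilbert_space
begin

lift_definition scaleC_ell2 :: "complex \<Rightarrow> 'a ell2 \<Rightarrow> 'a ell2" is "\<lambda>c x i. c * x i"
  by (rule ell2_scale_summable)

lift_definition cinner_ell2 :: "'a ell2 \<Rightarrow> 'a ell2 \<Rightarrow> complex"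
  is "\<lambda>x y. \<Sum>\<^sub>\<infinity>i. x i * cnj (y i)" .

instance
proof
  fix x y z :: "'a ell2" and c d :: complex and r :: real
  show "c *\<^sub>C (x + y) = c *\<^sub>C x + c *\<^sub>C y" by transfer (simp add: distrib_left)
  show "(c + d) *\<^sub>C x = c *\<^sub>C x + d *\<^sub>C x" by transfer (simp add: distrib_right)
  show "c *\<^sub>C d *\<^sub>C x = (c * d) *\<^sub>C x" by transfer (simp add: mult.assoc)
  show "complex_of_real r *\<^sub>C x = r *\<^sub>R x" by transfer simp
  show "cinner x y = cnj (cinner y x)"
    by transfer (simp add: infsum_cnj[symmetric] mult.commute del: infsum_cnj)
  show "cinner (x + y) z = cinner x z + cinner y z"
    by transfer (simp add: distrib_right infsum_add ell2_prod_summable)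
  show "cinner (c *\<^sub>C x) y = c * cinner x y"
    by transfer (simp add: mult.assoc infsum_cmult_right')
  show "inner x y = Re (cinner x y)" by transfer simp
qed

end

text \<open>The canonical orthonormal basis.\<close>

lift_definition ell2_basis :: "'i \<Rightarrow> 'i ell2" is "\<lambda>k i. if i = k then 1 else 0"
  by (rule finite_nonzero_values_imp_summable_on) simp


section \<open>Two-variable weighted shifts\<close>

definition weighted_shift2 ::
    "(nat \<times> nat \<Rightarrow> real) \<Rightarrow> (nat \<times> nat \<Rightarrow> real) \<Rightarrow> (nat \<times> nat) ell2 op_pair \<Rightarrow> bool" where
  "weighted_shift2 \<alpha> \<beta> = (\<lambda>(T\<^sub>1, T\<^sub>2).
     (\<forall>k. 0 < \<alpha> k) \<and> (\<forall>k. 0 < \<beta> k) \<and> bounded (range \<alpha>) \<and> bounded (range \<beta>) \<and>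
     bounded_clinear T\<^sub>1 \<and> bounded_clinear T\<^sub>2 \<and>
     (\<forall>k. T\<^sub>1 (ell2_basis k) = complex_of_real (\<alpha> k) *\<^sub>C ell2_basis (k + (1, 0))) \<and>
     (\<forall>k. T\<^sub>2 (ell2_basis k) = complex_of_real (\<beta> k) *\<^sub>C ell2_basis (k + (0, 1))))"

end

theory Submission
  imports Defs
begin

text \<open>
  On basis vectors everything is explicit: \<open>|T\<^sub>i|\<close> and \<open>P\<close> are diagonal with entries \<open>\<alpha>\<close>, \<open>\<beta>\<close> and
  \<open>p = sqrt (\<alpha>\<^sup>2 + \<beta>\<^sup>2)\<close>, and the partial isometries are again weighted shifts. Comparing weights,
  invariance under the toral transform says that \<open>\<alpha>\<close> is constant in the first direction and \<open>\<beta>\<close> in the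
  second, and invariance under the spherical transform that \<open>\<alpha>\<^sup>2 + \<beta>\<^sup>2\<close> is constant. Hence both \<open>\<alpha>\<close> and \<open>\<beta>\<close>
  are constant, so \<open>T\<^sub>1\<^sup>* T\<^sub>1\<close> and \<open>T\<^sub>2\<^sup>* T\<^sub>2\<close> are scalars and commute with everything.
\<close>

section \<open>Bounded complex-linear operators\<close>

lemma cinner_add_right: "cinner x (y + z) = cinner x y + cinner x z"
  using cinner_add_left[of y z x] cinner_commute by (metis complex_cnj_add)

lemma cinner_scaleC_right: "cinner x (c *\<^sub>C y) = cnj c * cinner x y"
  using cinner_scaleC_left[of c y x] cinner_commute by (metis complex_cnj_mult)

lemma cinner_self: "cinner x x = complex_of_real ((norm x)\<^sup>2)"
proof (rule complex_eqI)
  show "Re (cinner x x) = Re (complex_of_real ((norm x)\<^sup>2))"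
    by (simp add: power2_norm_eq_inner inner_eq_Re_cinner)
  have "Im (cinner x x) = - Im (cinner x x)"
    using cinner_commute[of x x] by (metis cnj.sel(2))
  then show "Im (cinner x x) = Im (complex_of_real ((norm x)\<^sup>2))" by simp
qed

text \<open>Conjugate-linearity turns the factor \<i> in the second argument into -\<i>, which moves
  the imaginary part into the real part. This transfers the continuity of \<open>inner\<close> to
  \<open>cinner\<close>.\<close>

lemma cinner_eq_Complex_inner: "cinner x y = Complex (inner x y) (inner x (\<i> *\<^sub>C y))"
  by (simp add: complex_eq_iff inner_eq_Re_cinner cinner_scaleC_right)

lemma cinner_extensional:
  assumes "\<And>x. cinner x y = cinner x z"
  shows "y = z"
proof -
  have "inner (y - z) (y - z) = 0"
    using assms[of "y - z"] by (simp add: inner_eq_Re_cinner[symmetric] inner_diff_right)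
       (metis inner_eq_Re_cinner)
  then show ?thesis by simp
qed

lemma continuous_on_cinner_left [continuous_intros]:
  assumes "continuous_on A f"
  shows "continuous_on A (\<lambda>x. cinner (f x) y)"
  unfolding cinner_eq_Complex_inner Complex_eq by (intro continuous_intros assms)

lemma bounded_clinear_add: "bounded_clinear T \<Longrightarrow> T (x + y) = T x + T y"
  by (simp add: bounded_clinear_def bounded_linear.axioms(1) linear_add)

lemma bounded_clinear_scaleC: "bounded_clinear T \<Longrightarrow> T (c *\<^sub>C x) = c *\<^sub>C T x"
  by (simp add: bounded_clinear_def)

lemma bounded_clinear_zero: "bounded_clinear T \<Longrightarrow> T 0 = 0"
  by (simp add: bounded_clinear_def linear_simps(3))

lemma bounded_clinear_continuous_on: "bounded_clinear T \<Longrightarrow> continuous_on A T"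
  by (simp add: bounded_clinear_def linear_continuous_on)

lemma bounded_clinear_compose:
  assumes "bounded_clinear S" "bounded_clinear T"
  shows "bounded_clinear (\<lambda>x. S (T x))"
  using assms bounded_linear_compose[of S T] by (auto simp: bounded_clinear_def)

lemma bounded_clinear_Pair:
  assumes "bounded_clinear S" "bounded_clinear T"
  shows "bounded_clinear (\<lambda>x. (S x, T x))"
  using assms bounded_linear_Pair[of S T] by (auto simp: bounded_clinear_def scaleC_prod_def)

text \<open>\<open>cadjoint\<close> is a definite description, so exhibiting one bounded operator
  with the adjoint relation yields existence; uniqueness is nondegeneracy of the inner
  product.\<close>

lemma cadjoint_eqI:
  assumes "bounded_clinear S" "\<And>x y. cinner (T x) y = cinner x (S y)"
  shows "cadjoint T = S"
  unfolding cadjoint_def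
proof (rule the_equality)
  fix R assume "bounded_clinear R \<and> (\<forall>x y. cinner (T x) y = cinner x (R y))"
  then show "R = S" using assms(2) by (metis cinner_extensional ext)
qed (use assms in auto)

text \<open>This is the uniqueness of positive square roots at an eigenvector: the vector
  \<open>y = B x - d x\<close> satisfies \<open>B y = - d y\<close>, which positivity of \<open>B\<close> only allows for \<open>y = 0\<close>.\<close>

lemma positive_op_square_eigenvector:
  assumes B: "positive_op B" and "0 < d"
    and sq: "B (B x) = complex_of_real (d\<^sup>2) *\<^sub>C x"
  shows "B x = complex_of_real d *\<^sub>C x"
proof -
  have bc: "bounded_clinear B" using B by (simp add: positive_op_def)
  define y where "y = B x + complex_of_real (- d) *\<^sub>C x"
  have "B y = complex_of_real (- d) *\<^sub>C y"
    unfolding y_def bounded_clinear_add[OF bc] bounded_clinear_scaleC[OF bc] sq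
    by (simp add: scaleC_add_right scaleC_scaleC power2_eq_square add.commute flip: of_real_mult of_real_minus)
  then have "cinner (B y) y = complex_of_real (- d * (norm y)\<^sup>2)"
    by (simp add: cinner_scaleC_left cinner_self)
  then have "complex_of_real (- d * (norm y)\<^sup>2) \<in> \<real>\<^sub>\<ge>\<^sub>0"
    using B by (metis positive_op_def)
  then have "d * (norm y)\<^sup>2 \<le> 0" by (simp only: nonneg_Reals_of_real_iff)
  then have "y = 0" using \<open>0 < d\<close> by (simp add: mult_le_0_iff)
  then show ?thesis unfolding y_def by (simp add: scaleC_of_real flip: of_real_minus)
qed


section \<open>Operators on the space of square-summable families\<close>

lemma ell2_eqI: "(\<And>i. ell2_coord x i = ell2_coord y i) \<Longrightarrow> x = y"
  by (metis ell2_coord_inject ext)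

lemma cinner_ell2_basis_left: "cinner (ell2_basis k) y = cnj (ell2_coord y k)"
proof -
  have "cinner (ell2_basis k) y = (\<Sum>\<^sub>\<infinity>i. (if i = k then 1 else 0) * cnj (ell2_coord y i))"
    by (simp add: cinner_ell2.rep_eq ell2_basis.rep_eq)
  also have "\<dots> = (\<Sum>\<^sub>\<infinity>i\<in>{k}. cnj (ell2_coord y i))"
    by (rule infsum_cong_neutral) auto
  finally show ?thesis by simp
qed

lemma ell2_coord_sum: "ell2_coord (sum g F) i = (\<Sum>k\<in>F. ell2_coord (g k) i)"
  by (induction F rule: infinite_finite_induct) (auto simp: zero_ell2.rep_eq plus_ell2.rep_eq)

text \<open>The squared error of the partial sum over a finite set \<open>Y\<close> is the squared
  norm of \<open>x\<close> minus the sum of the squared moduli over \<open>Y\<close>, so convergence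
  reduces to that of the series for the squared norm.\<close>

lemma has_sum_ell2_basis: "((\<lambda>k. ell2_coord x k *\<^sub>C ell2_basis k) has_sum x) UNIV"
  unfolding has_sum_def tendsto_iff eventually_finite_subsets_at_top
proof (intro allI impI)
  fix e :: real assume "0 < e"
  let ?g = "\<lambda>i. (cmod (ell2_coord x i))\<^sup>2"
  have sm: "?g summable_on UNIV" using ell2_coord[of x] by simp
  then have "(?g has_sum (norm x)\<^sup>2) UNIV" by (simp add: ell2_norm_square)
  then obtain X where X: "finite X" "\<And>Y. finite Y \<Longrightarrow> X \<subseteq> Y \<Longrightarrow> dist (sum ?g Y) ((norm x)\<^sup>2) < e\<^sup>2"
    using \<open>0 < e\<close> unfolding has_sum_def tendsto_iff eventually_finite_subsets_at_top
    by (metis subset_UNIV zero_less_power)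
  show "\<exists>X. finite X \<and> X \<subseteq> UNIV \<and> (\<forall>Y. finite Y \<and> X \<subseteq> Y \<and> Y \<subseteq> UNIV \<longrightarrow>
      dist (\<Sum>k\<in>Y. ell2_coord x k *\<^sub>C ell2_basis k) x < e)"
  proof (intro exI[of _ X] conjI allI impI)
    fix Y assume Y: "finite Y \<and> X \<subseteq> Y \<and> Y \<subseteq> UNIV"
    let ?s = "\<Sum>k\<in>Y. ell2_coord x k *\<^sub>C ell2_basis k"
    have cs: "ell2_coord (x - ?s) i = (if i \<in> Y then 0 else ell2_coord x i)" for i
      using Y by (auto simp: ell2_coord_diff ell2_coord_sum scaleC_ell2.rep_eq ell2_basis.rep_eq
          if_distrib sum.delta' cong: if_cong)
    have "(norm (x - ?s))\<^sup>2 = (\<Sum>\<^sub>\<infinity>i\<in>UNIV - Y. ?g i)"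
      unfolding ell2_norm_square cs by (rule infsum_cong_neutral) auto
    also have "\<dots> = (norm x)\<^sup>2 - sum ?g Y"
      unfolding ell2_norm_square using Y by (subst infsum_Diff) (auto intro: sm)
    also have "\<dots> < e\<^sup>2" using X(2)[of Y] Y by (simp add: dist_real_def abs_if split: if_splits)
    finally show "dist ?s x < e"
      using \<open>0 < e\<close> by (metis dist_commute dist_norm less_imp_le power_less_imp_less_base)
  qed (use X in auto)
qed

text \<open>Density of the span of the basis, packaged as an induction rule: every vector is a limit
  of finite combinations of basis vectors, and closedness carries the property to the limit.\<close>

lemma ell2_dense_induct [case_names closed basis add scaleC]:
  fixes P :: "'i ell2 \<Rightarrow> bool"
  assumes cl: "closed {x. P x}"
    and basis: "\<And>k. P (ell2_basis k)"
    and add: "\<And>x y. P x \<Longrightarrow> P y \<Longrightarrow> P (x + y)"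
    and scaleC: "\<And>c x. P x \<Longrightarrow> P (c *\<^sub>C x)"
  shows "P x"
proof -
  \<comment> \<open>The empty sum is covered by writing zero as 0 times a basis vector.\<close>
  have P0: "P 0"
    using scaleC[OF basis, of 0] by (metis of_real_0 scaleC_of_real scaleR_zero_left)
  have "P (\<Sum>k\<in>F. ell2_coord x k *\<^sub>C ell2_basis k)" if "finite F" for F
    using that by induction (auto intro: P0 add scaleC basis)
  then have "\<forall>\<^sub>F F in finite_subsets_at_top UNIV.
      (\<Sum>k\<in>F. ell2_coord x k *\<^sub>C ell2_basis k) \<in> {x. P x}"
    by (auto intro: eventually_finite_subsets_at_top_weakI)
  from Lim_in_closed_set[OF cl this _ has_sum_ell2_basis[unfolded has_sum_def]]
  show ?thesis by simp
qed

lemma bounded_clinear_ell2_eqI: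
  fixes S T :: "'i ell2 \<Rightarrow> 'b::chilbert_space"
  assumes S: "bounded_clinear S" and T: "bounded_clinear T"
    and eq: "\<And>k. S (ell2_basis k) = T (ell2_basis k)"
  shows "S = T"
proof
  fix x show "S x = T x"
  proof (induction x rule: ell2_dense_induct)
    case closed
    then show ?case
      by (intro closed_Collect_eq bounded_clinear_continuous_on S T)
  qed (simp_all add: eq bounded_clinear_add[OF S] bounded_clinear_add[OF T]
      bounded_clinear_scaleC[OF S] bounded_clinear_scaleC[OF T])
qed

text \<open>Both sides of the adjoint relation are linear and continuous in \<open>x\<close>, so
  basis vectors suffice there. Pairing with a basis vector extracts a coordinate, which lets a
  candidate adjoint be read off coordinatewise.\<close>

lemma cadjoint_ell2_eqI:
  fixes T :: "'i ell2 \<Rightarrow> 'b::chilbert_space"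
  assumes T: "bounded_clinear T" and S: "bounded_clinear S"
    and eq: "\<And>k y. cinner (T (ell2_basis k)) y = cnj (ell2_coord (S y) k)"
  shows "cinner (T x) y = cinner x (S y)" "cadjoint T = S"
proof -
  show *: "cinner (T x) y = cinner x (S y)" for x y
  proof (induction x rule: ell2_dense_induct)
    case closed
    then show ?case
      by (intro closed_Collect_eq continuous_intros bounded_clinear_continuous_on T)
  qed (simp_all add: eq cinner_ell2_basis_left bounded_clinear_add[OF T] cinner_add_left
      bounded_clinear_scaleC[OF T] cinner_scaleC_left)
  show "cadjoint T = S" by (rule cadjoint_eqI[OF S *])
qed

lemma bounded_range_power2:
  fixes c :: "'i \<Rightarrow> real"
  assumes "bounded (range c)"
  shows "bounded (range (\<lambda>i. (c i)\<^sup>2))"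
proof -
  obtain M where "\<And>i. \<bar>c i\<bar> \<le> M" using assms by (auto simp: bounded_iff)
  then have "\<bar>(c i)\<^sup>2\<bar> \<le> M\<^sup>2" for i by (metis abs_ge_zero abs_power2 power2_abs power_mono)
  then show ?thesis by (auto simp: bounded_iff)
qed

section \<open>Weighted composition operators\<close>

text \<open>One formula for three families: diagonal operators (\<open>f\<close> the identity),
  adjoints of shifts (\<open>f\<close> the shift map) and shifts themselves (\<open>f\<close> an
  inverse of the shift map, with weight 0 off its range).\<close>

definition wcomp :: "('i \<Rightarrow> real) \<Rightarrow> ('i \<Rightarrow> 'j) \<Rightarrow> 'j ell2 \<Rightarrow> 'i ell2" where
  "wcomp c f x = Abs_ell2 (\<lambda>i. complex_of_real (c i) * ell2_coord x (f i))"

text \<open>On the support of \<open>c\<close> the terms are dominated by \<open>M\<^sup>2\<close>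
  times the squared moduli of \<open>x\<close> at \<open>f i\<close>. Reindexing along
  \<open>f\<close>, injective there, gives a sum over a subset of all indices.\<close>

lemma wcomp_bound:
  fixes x :: "'j ell2" and f :: "'i \<Rightarrow> 'j"
  assumes M: "\<And>i. \<bar>c i\<bar> \<le> M" and inj: "inj_on f {i. c i \<noteq> 0}"
  defines "h \<equiv> \<lambda>i. (cmod (complex_of_real (c i) * ell2_coord x (f i)))\<^sup>2"
  shows "h summable_on UNIV" "infsum h UNIV \<le> (M * norm x)\<^sup>2"
proof -
  let ?S = "{i. c i \<noteq> 0}"
  let ?g = "\<lambda>j. M\<^sup>2 * (cmod (ell2_coord x j))\<^sup>2"
  have g: "?g summable_on A" for A
    using ell2_coord[of x] by (intro summable_on_cmult_right) (auto intro: summable_on_subset_banach)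
  have gf: "(?g \<circ> f) summable_on ?S"
    using g summable_on_reindex[OF inj] by blast
  have hg: "h i \<le> (?g \<circ> f) i" for i
    unfolding h_def using M[of i]
    by (auto simp: norm_mult power_mult_distrib intro!: mult_right_mono)
       (metis abs_ge_zero power2_abs power_mono)
  have hS: "h summable_on ?S"
    by (rule summable_on_comparison_test[OF gf]) (use hg in \<open>auto simp: h_def\<close>)
  have "h summable_on ?S \<longleftrightarrow> h summable_on UNIV"
    by (rule summable_on_cong_neutral) (auto simp: h_def)
  with hS show "h summable_on UNIV" by simp
  have "infsum h UNIV = infsum h ?S"
    by (rule infsum_cong_neutral) (auto simp: h_def)
  also have "\<dots> \<le> infsum (?g \<circ> f) ?S"
    by (rule infsum_mono[OF hS gf hg])
  also have "\<dots> = infsum ?g (f ` ?S)"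
    using infsum_reindex[OF inj] by metis
  also have "\<dots> \<le> infsum ?g UNIV"
    by (rule infsum_mono_neutral[OF g g]) auto
  also have "\<dots> = (M * norm x)\<^sup>2"
    by (simp add: infsum_cmult_right' ell2_norm_square power_mult_distrib)
  finally show "infsum h UNIV \<le> (M * norm x)\<^sup>2" .
qed

context
  fixes c :: "'i \<Rightarrow> real" and f :: "'i \<Rightarrow> 'j"
  assumes bdd: "bounded (range c)" and inj: "inj_on f {i. c i \<noteq> 0}"
begin

lemma ell2_coord_wcomp: "ell2_coord (wcomp c f x) i = complex_of_real (c i) * ell2_coord x (f i)"
proof -
  obtain M where "\<And>i. \<bar>c i\<bar> \<le> M" using bdd by (auto simp: bounded_iff)
  from wcomp_bound(1)[OF this inj, of x] show ?thesis
    unfolding wcomp_def by (subst Abs_ell2_inverse) auto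
qed

lemma bounded_clinear_wcomp: "bounded_clinear (wcomp c f)"
proof -
  obtain M where M: "\<And>i. \<bar>c i\<bar> \<le> M" using bdd by (auto simp: bounded_iff)
  have "0 \<le> M" using M abs_ge_zero order_trans by blast
  have "bounded_linear (wcomp c f)"
  proof (rule bounded_linear_intro)
    fix x
    have "(norm (wcomp c f x))\<^sup>2 \<le> (M * norm x)\<^sup>2"
      unfolding ell2_norm_square[of "wcomp c f x"] ell2_coord_wcomp
      by (rule wcomp_bound(2)[OF M inj])
    then have "norm (wcomp c f x) \<le> M * norm x"
      by (rule power2_le_imp_le) (use \<open>0 \<le> M\<close> in simp)
    then show "norm (wcomp c f x) \<le> norm x * M" by (simp only: mult.commute)
  qed (auto intro!: ell2_eqI simp: ell2_coord_wcomp plus_ell2.rep_eq scaleR_ell2.rep_eq algebra_simps)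
  then show ?thesis
    by (auto intro!: ell2_eqI simp: bounded_clinear_def ell2_coord_wcomp scaleC_ell2.rep_eq)
qed

end

section \<open>Diagonal operators and their square roots\<close>

abbreviation diag_op :: "('i \<Rightarrow> real) \<Rightarrow> 'i ell2 \<Rightarrow> 'i ell2" where
  "diag_op d \<equiv> wcomp d (\<lambda>i. i)"

lemma diag_op_coord:
  "bounded (range d) \<Longrightarrow> ell2_coord (diag_op d x) i = complex_of_real (d i) * ell2_coord x i"
  by (simp add: ell2_coord_wcomp)

lemma bounded_clinear_diag_op: "bounded (range d) \<Longrightarrow> bounded_clinear (diag_op d)"
  by (simp add: bounded_clinear_wcomp)

lemma diag_op_basis:
  "bounded (range d) \<Longrightarrow> diag_op d (ell2_basis k) = complex_of_real (d k) *\<^sub>C ell2_basis k"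
  by (rule ell2_eqI) (simp add: diag_op_coord ell2_basis.rep_eq scaleC_ell2.rep_eq)

lemma diag_op_eq_0_iff:
  assumes "bounded (range d)" "\<And>k. 0 < d k"
  shows "diag_op d x = 0 \<longleftrightarrow> x = 0"
proof
  assume "diag_op d x = 0"
  then have "complex_of_real (d i) * ell2_coord x i = 0" for i
    by (metis diag_op_coord assms(1) zero_ell2.rep_eq)
  then show "x = 0" using assms(2) by (auto intro!: ell2_eqI simp: zero_ell2.rep_eq) (metis less_irrefl)
qed (simp add: bounded_clinear_zero bounded_clinear_diag_op assms)

text \<open>The quadratic form at \<open>x\<close> is the sum of \<open>d i\<close> times the
  squared modulus of the coordinate of \<open>x\<close> at \<open>i\<close>, hence real and
  nonnegative.\<close>

lemma positive_op_diag_op: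
  assumes "bounded (range d)" "\<And>k. 0 \<le> d k"
  shows "positive_op (diag_op d)"
proof -
  have "cinner (diag_op d x) x \<in> \<real>\<^sub>\<ge>\<^sub>0" for x
  proof -
    let ?g = "\<lambda>i. d i * (cmod (ell2_coord x i))\<^sup>2"
    have eq: "ell2_coord (diag_op d x) i * cnj (ell2_coord x i) = complex_of_real (?g i)" for i
      unfolding diag_op_coord[OF assms(1)] of_real_mult complex_norm_square mult.assoc ..
    have "(\<lambda>i. ell2_coord (diag_op d x) i * cnj (ell2_coord x i)) summable_on UNIV"
      using ell2_coord[of x] ell2_coord[of "diag_op d x"] by (intro ell2_prod_summable) auto
    then have sm: "(\<lambda>i. complex_of_real (?g i)) summable_on UNIV" unfolding eq .
    have "cinner (diag_op d x) x = (\<Sum>\<^sub>\<infinity>i. complex_of_real (?g i))"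
      unfolding cinner_ell2.rep_eq eq ..
    then show ?thesis
      using infsum_nonneg[of UNIV ?g] assms(2) infsum_Re[OF sm] infsum_Im[OF sm]
      by (simp add: complex_nonneg_Reals_iff)
  qed
  then show ?thesis by (simp add: positive_op_def bounded_clinear_diag_op assms)
qed

text \<open>Each basis vector is an eigenvector of the square of any positive root \<open>B\<close>,
  so by \<open>positive_op_square_eigenvector\<close> it is an eigenvector of \<open>B\<close> with
  eigenvalue \<open>d k\<close>. This determines \<open>B\<close>.\<close>

lemma op_sqrt_diag_op:
  assumes "bounded (range d)" and pos: "\<And>k. 0 < d k" and a: "\<And>k. a k = (d k)\<^sup>2"
  shows "op_sqrt (diag_op a) = diag_op d"
  unfolding op_sqrt_def
proof (rule the_equality)
  have "bounded (range a)"
    unfolding a by (rule bounded_range_power2[OF assms(1)])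
  have *: "diag_op d \<circ> diag_op d = diag_op a"
    by (rule ext, rule ell2_eqI)
      (simp add: diag_op_coord assms(1) diag_op_coord[OF \<open>bounded (range a)\<close>] a power2_eq_square)
  then show "positive_op (diag_op d) \<and> diag_op d \<circ> diag_op d = diag_op a"
    using assms(1) pos by (simp add: positive_op_diag_op less_imp_le)
  fix B assume B: "positive_op B \<and> B \<circ> B = diag_op a"
  show "B = diag_op d"
  proof (rule bounded_clinear_ell2_eqI)
    fix k
    have "B (B (ell2_basis k)) = complex_of_real ((d k)\<^sup>2) *\<^sub>C ell2_basis k"
      using B diag_op_basis[OF \<open>bounded (range a)\<close>, of k] by (metis a comp_apply)
    then show "B (ell2_basis k) = diag_op d (ell2_basis k)"
      using positive_op_square_eigenvector B pos diag_op_basis[OF assms(1)] by metis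
  qed (use B assms(1) bounded_clinear_diag_op in \<open>auto simp: positive_op_def\<close>)
qed


section \<open>Weighted shifts along an injection\<close>

text \<open>A general injection \<open>f\<close> treats both coordinate directions, and the factors
  of the polar decompositions, uniformly.\<close>

definition is_shift :: "('i \<Rightarrow> 'i) \<Rightarrow> ('i \<Rightarrow> real) \<Rightarrow> ('i ell2 \<Rightarrow> 'i ell2) \<Rightarrow> bool" where
  "is_shift f c T \<longleftrightarrow> inj f \<and> bounded (range c) \<and> bounded_clinear T \<and>
     (\<forall>k. T (ell2_basis k) = complex_of_real (c k) *\<^sub>C ell2_basis (f k))"

lemma is_shift_exists:
  fixes f :: "'i \<Rightarrow> 'i"
  assumes inj: "inj f" and bdd: "bounded (range c)"
  shows "\<exists>T. is_shift f c T"
proof -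
  \<comment> \<open>The weight is transported to the target index. The value 0 off the range of
    \<open>f\<close> masks the arbitrary values of \<open>inv f\<close> there.\<close>
  define c' where "c' = (\<lambda>j. if j \<in> range f then c (inv f j) else 0)"
  have "range c' \<subseteq> insert 0 (range c)" by (auto simp: c'_def)
  then have b': "bounded (range c')" using bdd by (meson bounded_insert bounded_subset)
  have i': "inj_on (inv f) {j. c' j \<noteq> 0}"
    by (rule inj_on_inv_into) (auto simp: c'_def split: if_splits)
  have "c' (f k) = c k" for k using inj by (simp add: c'_def)
  moreover have "inv f i = k \<Longrightarrow> i \<noteq> f k \<Longrightarrow> c' i = 0" for i k
    by (auto simp: c'_def f_inv_into_f)
  ultimately have "wcomp c' (inv f) (ell2_basis k) = complex_of_real (c k) *\<^sub>C ell2_basis (f k)" for k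
    by (intro ell2_eqI)
      (use inj in \<open>auto simp: ell2_coord_wcomp[OF b' i'] ell2_basis.rep_eq scaleC_ell2.rep_eq inv_f_f\<close>)
  then show ?thesis
    using bounded_clinear_wcomp[OF b' i'] inj bdd by (auto simp: is_shift_def)
qed

text \<open>The adjoint is the backward shift \<open>wcomp c f\<close>, which sends the basis vector
  at \<open>f k\<close> to \<open>c k\<close> times the one at \<open>k\<close>. Going forth and
  back picks up the weight twice.\<close>

lemma is_shift_adjoint:
  fixes T :: "'i ell2 \<Rightarrow> 'i ell2"
  assumes T: "is_shift f c T"
  shows "cinner (T x) y = cinner x (cadjoint T y)"
    and "cadjoint T (T x) = diag_op (\<lambda>k. (c k)\<^sup>2) x"
proof -
  have bc: "bounded_clinear T" and inj: "inj f" and bdd: "bounded (range c)"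
    and Tb: "\<And>k. T (ell2_basis k) = complex_of_real (c k) *\<^sub>C ell2_basis (f k)"
    using T by (auto simp: is_shift_def)
  have inj': "inj_on f {i. c i \<noteq> 0}" using inj inj_on_subset by blast
  note S = bounded_clinear_wcomp[OF bdd inj']
  have eq: "cinner (T (ell2_basis k)) y = cnj (ell2_coord (wcomp c f y) k)" for k y
    by (simp add: Tb cinner_scaleC_left cinner_ell2_basis_left ell2_coord_wcomp[OF bdd inj'])
  note adj = cadjoint_ell2_eqI[OF bc S eq]
  show "cinner (T x) y = cinner x (cadjoint T y)" using adj by simp
  have b2: "bounded (range (\<lambda>k. (c k)\<^sup>2))" by (rule bounded_range_power2[OF bdd])
  have "(\<lambda>x. wcomp c f (T x)) = diag_op (\<lambda>k. (c k)\<^sup>2)"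
  proof (rule bounded_clinear_ell2_eqI)
    fix k
    have "wcomp c f (ell2_basis (f k)) = complex_of_real (c k) *\<^sub>C ell2_basis k"
      by (rule ell2_eqI)
        (use inj in \<open>auto simp: ell2_coord_wcomp[OF bdd inj'] ell2_basis.rep_eq scaleC_ell2.rep_eq inj_eq\<close>)
    then show "wcomp c f (T (ell2_basis k)) = diag_op (\<lambda>k. (c k)\<^sup>2) (ell2_basis k)"
      by (simp add: Tb bounded_clinear_scaleC[OF S] diag_op_basis[OF b2] scaleC_scaleC)
        (simp add: power2_eq_square)
  qed (rule bounded_clinear_compose[OF S bc] bounded_clinear_diag_op[OF b2])+
  then show "cadjoint T (T x) = diag_op (\<lambda>k. (c k)\<^sup>2) x" using adj(2) by metis
qed


lemma is_shift_basis:
  "is_shift f c T \<Longrightarrow> T (ell2_basis k) = complex_of_real (c k) *\<^sub>C ell2_basis (f k)"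
  by (simp add: is_shift_def)

lemma is_shift_bounded_clinear: "is_shift f c T \<Longrightarrow> bounded_clinear T"
  by (simp add: is_shift_def)

lemma is_shift_bounded: "is_shift f c T \<Longrightarrow> bounded (range c)"
  by (simp add: is_shift_def)

lemma is_shift_norm_square:
  assumes "is_shift f c T"
  shows "complex_of_real ((norm (T x))\<^sup>2) = cinner x (diag_op (\<lambda>k. (c k)\<^sup>2) x)"
  unfolding cinner_self[symmetric] is_shift_adjoint[OF assms] ..

section \<open>Polar factors and fixed points of the Aluthge transforms\<close>

text \<open>An isometry and a diagonal operator with positive entries are both injective, so all
  kernels involved are trivial. Any competing factor agrees with \<open>V\<close> on
  \<open>d k\<close> times each basis vector, and \<open>d k\<close> can be cancelled. The free
  codomain admits column operators too.\<close>

lemma polar_factor_diag_op: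
  fixes T :: "'i ell2 \<Rightarrow> 'b::chilbert_space"
  assumes bdd: "bounded (range d)" and pos: "\<And>k. 0 < d k"
    and V: "bounded_clinear V" "\<And>x. norm (V x) = norm x"
    and T: "T = V \<circ> diag_op d"
  shows "polar_factor T (diag_op d) = V"
  unfolding polar_factor_def
proof (rule the_equality)
  have V0: "V x = 0 \<longleftrightarrow> x = 0" for x by (metis V(2) norm_eq_zero)
  then have "op_kernel V = op_kernel T"
    by (simp add: op_kernel_def T diag_op_eq_0_iff[OF bdd pos])
  then show "partial_isometry V \<and> T = V \<circ> diag_op d \<and> op_kernel V = op_kernel T"
    using V T by (simp add: partial_isometry_def)
  fix R assume R: "partial_isometry R \<and> T = R \<circ> diag_op d \<and> op_kernel R = op_kernel T"
  then have bR: "bounded_clinear R" by (simp add: partial_isometry_def)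
  show "R = V"
  proof (rule bounded_clinear_ell2_eqI[OF bR V(1)])
    fix k
    have "R (diag_op d (ell2_basis k)) = V (diag_op d (ell2_basis k))"
      using R T by (metis comp_apply)
    then have "complex_of_real (d k) *\<^sub>C R (ell2_basis k) = complex_of_real (d k) *\<^sub>C V (ell2_basis k)"
      by (simp only: diag_op_basis[OF bdd] bounded_clinear_scaleC[OF bR]
          bounded_clinear_scaleC[OF V(1)])
    then show "R (ell2_basis k) = V (ell2_basis k)"
      using pos[of k] by (simp add: scaleC_of_real)
  qed
qed

lemma bounded_range_sqrt:
  fixes d :: "'i \<Rightarrow> real"
  assumes "bounded (range d)" "\<And>k. 0 < d k"
  shows "bounded (range (\<lambda>k. sqrt (d k)))"
proof -
  obtain M where "\<And>i. \<bar>d i\<bar> \<le> M" using assms by (auto simp: bounded_iff)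
  then have "\<bar>sqrt (d i)\<bar> \<le> sqrt M" for i
    using assms(2)[of i] by (metis abs_of_pos real_sqrt_gt_zero real_sqrt_le_mono)
  then show ?thesis by (auto simp: bounded_iff)
qed

lemma op_sqrt_diag_op_sqrt:
  assumes "bounded (range d)" "\<And>k. 0 < d k"
  shows "op_sqrt (diag_op d) = diag_op (\<lambda>k. sqrt (d k))"
  using assms by (intro op_sqrt_diag_op bounded_range_sqrt) (auto simp: less_imp_le)

text \<open>The core of both transforms: at the basis vector \<open>k\<close> the sandwich has
  weight \<open>sqrt (d k) * v k * sqrt (d (f k))\<close>, while \<open>T\<close> has weight
  \<open>v k * d k\<close>. Cancelling positive factors leaves equal square roots.\<close>

lemma sandwich_eq_imp_invariant:
  assumes T: "is_shift f c T" and V: "is_shift f v V"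
    and d: "bounded (range d)" "\<And>k. 0 < d k" and v: "\<And>k. 0 < v k"
    and c: "\<And>k. c k = v k * d k"
    and eq: "op_sqrt (diag_op d) \<circ> V \<circ> op_sqrt (diag_op d) = T"
  shows "d (f k) = d k"
proof -
  note s = bounded_range_sqrt[OF d]
  have "T (ell2_basis k) = diag_op (\<lambda>k. sqrt (d k)) (V (diag_op (\<lambda>k. sqrt (d k)) (ell2_basis k)))"
    unfolding eq[symmetric] op_sqrt_diag_op_sqrt[OF d] by simp
  then have "complex_of_real (c k) *\<^sub>C ell2_basis (f k)
      = complex_of_real (sqrt (d k) * v k * sqrt (d (f k))) *\<^sub>C ell2_basis (f k)"
    by (simp add: is_shift_basis[OF T] is_shift_basis[OF V] diag_op_basis[OF s]
        bounded_clinear_scaleC[OF is_shift_bounded_clinear[OF V]]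
        bounded_clinear_scaleC[OF bounded_clinear_diag_op[OF s]] scaleC_scaleC mult.assoc)
  from arg_cong[OF this, of "\<lambda>x. Re (ell2_coord x (f k))"]
  have "v k * d k = sqrt (d k) * v k * sqrt (d (f k))"
    by (simp add: scaleC_ell2.rep_eq ell2_basis.rep_eq c)
  moreover have "d k = sqrt (d k) * sqrt (d k)" using d(2)[of k] by simp
  ultimately have "(sqrt (d k) * v k) * sqrt (d k) = (sqrt (d k) * v k) * sqrt (d (f k))"
    by (metis mult.commute mult.left_commute)
  then have "sqrt (d k) = sqrt (d (f k))"
    using d(2)[of k] v[of k] by (metis less_irrefl mult_cancel_left mult_pos_pos real_sqrt_gt_zero)
  then show ?thesis by simp
qed

text \<open>The modulus of \<open>T\<close> is the diagonal operator of its weights and the polar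
  factor is the unweighted shift along \<open>f\<close>, an isometry; the sandwich comparison then
  applies with \<open>d = c\<close> and \<open>v = 1\<close>.\<close>

lemma aluthge_fixed_imp_invariant:
  fixes T :: "'i ell2 \<Rightarrow> 'i ell2"
  assumes T: "is_shift f c T" and pos: "\<And>k. 0 < c k" and fixed: "aluthge T = T"
  shows "c (f k) = c k"
proof -
  note bdd = is_shift_bounded[OF T]
  have "cadjoint T \<circ> T = diag_op (\<lambda>k. (c k)\<^sup>2)" using is_shift_adjoint(2)[OF T] by auto
  then have abs: "op_abs T = diag_op c"
    unfolding op_abs_def by (simp add: op_sqrt_diag_op[OF bdd pos])
  obtain V where V: "is_shift f (\<lambda>_. 1) V"
    using is_shift_exists[of f "\<lambda>_. 1"] T by (auto simp: is_shift_def)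
  note bV = is_shift_bounded_clinear[OF V]
  have "diag_op (\<lambda>k. (1::real)\<^sup>2) x = x" for x :: "'i ell2"
    by (rule ell2_eqI) (simp add: diag_op_coord)
  then have "complex_of_real ((norm (V x))\<^sup>2) = complex_of_real ((norm x)\<^sup>2)" for x
    by (simp only: is_shift_norm_square[OF V] cinner_self)
  then have iso: "norm (V x) = norm x" for x by (simp only: of_real_eq_iff) simp
  have "T = V \<circ> diag_op c" unfolding comp_def
    by (rule bounded_clinear_ell2_eqI)
      (simp_all add: bounded_clinear_compose bV is_shift_bounded_clinear[OF T]
        bounded_clinear_diag_op[OF bdd] diag_op_basis[OF bdd] is_shift_basis[OF T]
        is_shift_basis[OF V] bounded_clinear_scaleC[OF bV] scaleC_scaleC)
  from polar_factor_diag_op[OF bdd pos bV iso this]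
  show ?thesis
    using fixed by (intro sandwich_eq_imp_invariant[OF T V bdd pos]) (simp_all add: aluthge_def abs)
qed

text \<open>The spherical modulus is diagonal with entries \<open>p\<close>, and the polar factor of
  the column consists of the shifts with weights \<open>a k / p k\<close> and
  \<open>b k / p k\<close>. Each component is then a sandwich with the same
  \<open>d = p\<close>.\<close>

lemma spherical_aluthge_fixed_imp_invariant:
  fixes T\<^sub>1 T\<^sub>2 :: "'i ell2 \<Rightarrow> 'i ell2"
  assumes T1: "is_shift f a T\<^sub>1" and T2: "is_shift g b T\<^sub>2"
    and a: "\<And>k. 0 < a k" and b: "\<And>k. 0 < b k"
    and fixed: "spherical_aluthge (T\<^sub>1, T\<^sub>2) = (T\<^sub>1, T\<^sub>2)"
  defines "p \<equiv> \<lambda>k. sqrt ((a k)\<^sup>2 + (b k)\<^sup>2)"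
  shows "p (f k) = p k" "p (g k) = p k"
proof -
  note a2 = bounded_range_power2[OF is_shift_bounded[OF T1]]
  note b2 = bounded_range_power2[OF is_shift_bounded[OF T2]]
  have p2: "bounded (range (\<lambda>k. (a k)\<^sup>2 + (b k)\<^sup>2))"
    by (rule bounded_plus_comp[OF a2 b2])
  have pos2: "0 < (a k)\<^sup>2 + (b k)\<^sup>2" for k using a[of k] by (simp add: add_pos_nonneg)
  have p: "bounded (range p)" unfolding p_def by (rule bounded_range_sqrt[OF p2 pos2])
  have pos: "0 < p k" for k unfolding p_def using pos2 by simp
  then have pne: "p k \<noteq> 0" for k by (metis less_irrefl)
  have "(\<lambda>x. cadjoint T\<^sub>1 (T\<^sub>1 x) + cadjoint T\<^sub>2 (T\<^sub>2 x)) = diag_op (\<lambda>k. (a k)\<^sup>2 + (b k)\<^sup>2)"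
    unfolding is_shift_adjoint(2)[OF T1] is_shift_adjoint(2)[OF T2]
    by (rule ext, rule ell2_eqI)
      (simp add: plus_ell2.rep_eq diag_op_coord[OF a2] diag_op_coord[OF b2] diag_op_coord[OF p2]
        distrib_right)
  then have mod: "spherical_modulus (T\<^sub>1, T\<^sub>2) = diag_op p"
    by (simp add: spherical_modulus_def op_sqrt_diag_op_sqrt[OF p2 pos2] p_def)
  define v where "v = (\<lambda>k. a k / p k)"
  define w where "w = (\<lambda>k. b k / p k)"
  have vpos: "0 < v k" and wpos: "0 < w k" for k
    using a b pos by (auto simp: v_def w_def)
  have vw: "(v k)\<^sup>2 + (w k)\<^sup>2 = 1" for k
    using less_imp_neq[OF pos2[of k]]
    unfolding v_def w_def p_def power_divide real_sqrt_pow2[OF less_imp_le[OF pos2]]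
      add_divide_distrib[symmetric] by simp
  \<comment> \<open>Bounding the weights by 1 makes the two shifts available through
    \<open>is_shift_exists\<close>.\<close>
  have "(v k)\<^sup>2 \<le> 1" "(w k)\<^sup>2 \<le> 1" for k using vw[of k] by (smt (verit) zero_le_power2)+
  then have bv: "bounded (range v)" and bw: "bounded (range w)"
    by (auto simp: bounded_iff abs_square_le_1)
  obtain V where V: "is_shift f v V"
    using is_shift_exists[OF _ bv, of f] T1 by (auto simp: is_shift_def)
  obtain W where W: "is_shift g w W"
    using is_shift_exists[OF _ bw, of g] T2 by (auto simp: is_shift_def)
  note bV = is_shift_bounded_clinear[OF V] and bW = is_shift_bounded_clinear[OF W]
  \<comment> \<open>Neither \<open>V\<close> nor \<open>W\<close> alone is an isometry, but the
    column is: by \<open>vw\<close> the two diagonal operators of squared weights add up to the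
    identity.\<close>
  have "complex_of_real ((norm (V x, W x))\<^sup>2) = complex_of_real ((norm x)\<^sup>2)" for x
  proof -
    have "complex_of_real ((norm (V x, W x))\<^sup>2)
        = complex_of_real ((norm (V x))\<^sup>2) + complex_of_real ((norm (W x))\<^sup>2)"
      by (simp add: norm_Pair)
    also have "\<dots> = cinner x (diag_op (\<lambda>k. (v k)\<^sup>2) x + diag_op (\<lambda>k. (w k)\<^sup>2) x)"
      unfolding is_shift_norm_square[OF V] is_shift_norm_square[OF W] cinner_add_right ..
    also have "diag_op (\<lambda>k. (v k)\<^sup>2) x + diag_op (\<lambda>k. (w k)\<^sup>2) x = x"
      by (rule ell2_eqI, unfold plus_ell2.rep_eq diag_op_coord[OF bounded_range_power2[OF bv]]
          diag_op_coord[OF bounded_range_power2[OF bw]] distrib_right[symmetric]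
          of_real_add[symmetric] vw) simp
    finally show ?thesis by (simp add: cinner_self)
  qed
  then have iso: "norm (V x, W x) = norm x" for x by (simp only: of_real_eq_iff) simp
  have T1V: "T\<^sub>1 = (\<lambda>x. V (diag_op p x))"
    by (rule bounded_clinear_ell2_eqI)
      (simp_all add: bounded_clinear_compose bV is_shift_bounded_clinear[OF T1]
        bounded_clinear_diag_op[OF p] diag_op_basis[OF p] is_shift_basis[OF T1]
        is_shift_basis[OF V] bounded_clinear_scaleC[OF bV] scaleC_scaleC v_def pne)
  have T2W: "T\<^sub>2 = (\<lambda>x. W (diag_op p x))"
    by (rule bounded_clinear_ell2_eqI)
      (simp_all add: bounded_clinear_compose bW is_shift_bounded_clinear[OF T2]
        bounded_clinear_diag_op[OF p] diag_op_basis[OF p] is_shift_basis[OF T2]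
        is_shift_basis[OF W] bounded_clinear_scaleC[OF bW] scaleC_scaleC w_def pne)
  have "column_op (T\<^sub>1, T\<^sub>2) = (\<lambda>x. (V x, W x)) \<circ> diag_op p"
    unfolding column_op_def by (simp add: fun_eq_iff fun_cong[OF T1V] fun_cong[OF T2W])
  from polar_factor_diag_op[OF p pos bounded_clinear_Pair[OF bV bW] iso this]
  have pf: "polar_factor (column_op (T\<^sub>1, T\<^sub>2)) (diag_op p) = (\<lambda>x. (V x, W x))" .
  have fs: "fst \<circ> (\<lambda>x. (V x, W x)) = V" "snd \<circ> (\<lambda>x. (V x, W x)) = W" by auto
  have eq: "op_sqrt (diag_op p) \<circ> V \<circ> op_sqrt (diag_op p) = T\<^sub>1"
    "op_sqrt (diag_op p) \<circ> W \<circ> op_sqrt (diag_op p) = T\<^sub>2"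
    using fixed unfolding spherical_aluthge_def Let_def mod pf fs by auto
  have cancel: "a k = v k * p k" "b k = w k * p k" for k
    using pos[of k] by (simp_all add: v_def w_def)
  show "p (f k) = p k"
    by (rule sandwich_eq_imp_invariant[OF T1 V p pos vpos cancel(1) eq(1)])
  show "p (g k) = p k"
    by (rule sandwich_eq_imp_invariant[OF T2 W p pos wpos cancel(2) eq(2)])
qed

section \<open>Constant weights and joint quasinormality\<close>

lemma nat_prod_invariant_imp_constant:
  fixes h :: "nat \<times> nat \<Rightarrow> 'a"
  assumes "\<And>k. h (k + (1, 0)) = h k" "\<And>k. h (k + (0, 1)) = h k"
  shows "h k = h (0, 0)"
proof -
  have 1: "h (Suc m, n) = h (m, n)" and 2: "h (m, Suc n) = h (m, n)" for m n
    using assms[of "(m, n)"] by simp_all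
  have "h (m, n) = h (0, n)" for m n by (induction m) (simp_all add: 1)
  moreover have "h (0, n) = h (0, 0)" for n by (induction n) (simp_all add: 2)
  ultimately show ?thesis by (metis surj_pair)
qed

theorem theorem3p14:
  fixes \<alpha> \<beta> :: "nat \<times> nat \<Rightarrow> real"
    and W :: "(nat \<times> nat) ell2 op_pair"
  assumes "weighted_shift2 \<alpha> \<beta> W"
    and "commuting_pair W"
    and "toral_aluthge W = W"
    and "spherical_aluthge W = W"
  shows "jointly_quasinormal W"
proof -
  obtain T1 T2 where W: "W = (T1, T2)" by (cases W)
  let ?f = "\<lambda>k::nat \<times> nat. k + (1, 0)" and ?g = "\<lambda>k::nat \<times> nat. k + (0, 1)"
  have pos: "\<And>k. 0 < \<alpha> k" "\<And>k. 0 < \<beta> k"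
    and T1: "is_shift ?f \<alpha> T1" and T2: "is_shift ?g \<beta> T2"
    using assms(1) by (auto simp: W weighted_shift2_def is_shift_def inj_def)
  have fixed: "aluthge T1 = T1" "aluthge T2 = T2"
    using assms(3) by (simp_all add: W toral_aluthge_def)
  have \<alpha>f: "\<alpha> (?f k) = \<alpha> k" and \<beta>g: "\<beta> (?g k) = \<beta> k" for k
    using aluthge_fixed_imp_invariant[OF T1 pos(1) fixed(1)]
      aluthge_fixed_imp_invariant[OF T2 pos(2) fixed(2)] by auto
  note sph = spherical_aluthge_fixed_imp_invariant[OF T1 T2 pos assms(4)[unfolded W]]
  \<comment> \<open>In each direction the toral condition fixes one of the two squares in the
    invariant sum, so the other is fixed as well; positivity then removes the squares.\<close>
  have "(\<beta> (?f k))\<^sup>2 = (\<beta> k)\<^sup>2" "(\<alpha> (?g k))\<^sup>2 = (\<alpha> k)\<^sup>2" for k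
    using sph(1)[of k] sph(2)[of k] unfolding real_sqrt_eq_iff \<alpha>f \<beta>g by linarith+
  then have \<beta>f: "\<beta> (?f k) = \<beta> k" and \<alpha>g: "\<alpha> (?g k) = \<alpha> k" for k
    using pos by (meson less_imp_le power2_eq_iff_nonneg)+
  have const: "\<alpha> k = \<alpha> (0, 0)" "\<beta> k = \<beta> (0, 0)" for k
    using nat_prod_invariant_imp_constant[of \<alpha>, OF \<alpha>f \<alpha>g]
      nat_prod_invariant_imp_constant[of \<beta>, OF \<beta>f \<beta>g] by blast+
  \<comment> \<open>A complex scalar is chosen because complex linearity of \<open>A\<close> then
    gives commutation for all four pairs at once.\<close>
  have scalar: "\<exists>c. \<forall>x. cadjoint B (B x) = c *\<^sub>C x"
    if "is_shift h \<gamma> B" "\<And>k. \<gamma> k = \<gamma> (0, 0)" for h \<gamma> and B :: "(nat \<times> nat) ell2 \<Rightarrow> (nat \<times> nat) ell2"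
  proof (intro exI allI)
    fix x
    show "cadjoint B (B x) = complex_of_real ((\<gamma> (0, 0))\<^sup>2) *\<^sub>C x"
      unfolding is_shift_adjoint(2)[OF that(1)] using that(2)
      by (intro ell2_eqI)
        (metis diag_op_coord[OF bounded_range_power2[OF is_shift_bounded[OF that(1)]]]
          scaleC_ell2.rep_eq)
  qed
  have "A \<circ> (cadjoint B \<circ> B) = (cadjoint B \<circ> B) \<circ> A" if AB: "A \<in> {T1, T2}" "B \<in> {T1, T2}" for A B
  proof -
    obtain c where "\<And>x. cadjoint B (B x) = c *\<^sub>C x"
      using scalar[OF T1 const(1)] scalar[OF T2 const(2)] AB(2) by auto
    moreover have "bounded_clinear A"
      using AB(1) is_shift_bounded_clinear T1 T2 by blast
    ultimately show ?thesis by (simp add: fun_eq_iff bounded_clinear_scaleC)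
  qed
  then show ?thesis using assms(2) by (auto simp: W jointly_quasinormal_def)
qed

end
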